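(* Let $G$ be a finitely generated abelian group and let $\varphi\in\mathrm{End}(G)$ be surjective. Then $s(\varphi)=0$ if and only if $\varphi$ is periodic.
   Context: $\mathbb N=\{0,1,2,\dots\}$ and $\mathbb N_+=\mathbb N\setminus\{0\}$. An endomorphism $\varphi$ of an abelian group $G$ is periodic if there exists $n\in\mathbb N_+$ such that $\varphi^n(x)=x$ for every $x\in G$. A string of $\varphi$ is a sequence $S=\{x_n\}_{n\in\mathbb N}$ of pairwise distinct elements of $G$ with $\varphi(x_n)=x_{n-1}$ for every $n\in\mathbb N_+$. The string number is $s(\varphi)=\sup\{|\mathcal F|:\mathcal F$ is a family of pairwise disjoint strings of $\varphi$ in $G\}$ (disjointness refers to the underlying sets of elements); it takes values in $\mathbb N\cup\{\infty\}$, i.e. it is set equal to $\infty$ whenever the supremum is infinite. *)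

theory Defs
  imports "HOL-Algebra.Generated_Groups" "HOL-Library.Extended_Nat"
begin

definition finitely_generated :: "('a, 'b) monoid_scheme \<Rightarrow> bool" where
  "finitely_generated G \<longleftrightarrow> (\<exists>S. finite S \<and> S \<subseteq> carrier G \<and> generate G S = carrier G)"

definition periodic :: "('a, 'b) monoid_scheme \<Rightarrow> ('a \<Rightarrow> 'a) \<Rightarrow> bool" where
  "periodic G \<phi> \<longleftrightarrow> (\<exists>n::nat. n > 0 \<and> (\<forall>x \<in> carrier G. (\<phi> ^^ n) x = x))"

definition is_string :: "('a, 'b) monoid_scheme \<Rightarrow> ('a \<Rightarrow> 'a) \<Rightarrow> (nat \<Rightarrow> 'a) \<Rightarrow> bool" where
  "is_string G \<phi> x \<longleftrightarrow> range x \<subseteq> carrier G \<and> inj x \<and> (\<forall>n>0. \<phi> (x n) = x (n - 1))"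

definition disjoint_strings :: "('a, 'b) monoid_scheme \<Rightarrow> ('a \<Rightarrow> 'a) \<Rightarrow> (nat \<Rightarrow> 'a) set \<Rightarrow> bool" where
  "disjoint_strings G \<phi> F \<longleftrightarrow>
     (\<forall>x \<in> F. is_string G \<phi> x) \<and> pairwise (\<lambda>x y. disjnt (range x) (range y)) F"

(* card returns 0 on infinite sets, so infinite families need their own case. *)
definition ecard :: "'c set \<Rightarrow> enat" where
  "ecard F = (if finite F then enat (card F) else \<infinity>)"

definition string_number :: "('a, 'b) monoid_scheme \<Rightarrow> ('a \<Rightarrow> 'a) \<Rightarrow> enat" where
  "string_number G \<phi> = Sup {ecard F |F. disjoint_strings G \<phi> F}"

end

theory Submission
  imports Defs
begin

text \<open>Any nonempty family contributes at least one to the supremum, so the string number vanishes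
  exactly when the endomorphism has no string at all. A periodic map has no string: some power
  \<open>n > 0\<close> of the map sends the \<open>n\<close>-th entry of a string to the initial entry, but fixes it.

  For the converse, surjectivity lets one start at any point \<open>x\<close> and choose preimages forever. A
  repetition in the resulting sequence, pushed forward far enough, makes \<open>x\<close> return to itself; so
  a point that never returns is the start of a string (\<open>string_if_never_returns\<close>). In the absence of
  strings every point is therefore a periodic point. Finite generation turns these individual
  periods into a common one: the product of the periods of the generators works for each
  generator, and the fixed points of a power of the endomorphism form a subgroup.\<close>

lemma funpow_string:
  assumes "\<And>n. f (x (Suc n)) = x n"
  shows "(f ^^ k) (x (k + n)) = x n"
  by (induction k) (simp_all add: assms funpow_Suc_right del: funpow.simps)

lemma string_number_eq_0_iff: "string_number G \<phi> = 0 \<longleftrightarrow> (\<nexists>x. is_string G \<phi> x)"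
proof
  assume zero: "string_number G \<phi> = 0"
  show "\<nexists>x. is_string G \<phi> x"
  proof
    assume "\<exists>x. is_string G \<phi> x"
    then obtain x where "is_string G \<phi> x" ..
    then have "disjoint_strings G \<phi> {x}"
      by (simp add: disjoint_strings_def)
    then have "ecard {x} \<le> string_number G \<phi>"
      unfolding string_number_def by (blast intro: Sup_upper)
    with zero show False
      by (simp add: ecard_def zero_enat_def)
  qed
next
  assume "\<nexists>x. is_string G \<phi> x"
  then have "disjoint_strings G \<phi> F \<longleftrightarrow> F = {}" for F
    by (auto simp: disjoint_strings_def)
  then show "string_number G \<phi> = 0"
    by (simp add: string_number_def ecard_def zero_enat_def)
qed

lemma no_string_if_periodic:
  assumes "periodic G \<phi>"
  shows "\<not> is_string G \<phi> x"
proof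
  assume x: "is_string G \<phi> x"
  from assms obtain n where n: "n > 0" and fix_n: "\<And>y. y \<in> carrier G \<Longrightarrow> (\<phi> ^^ n) y = y"
    by (auto simp: periodic_def)
  have "(\<phi> ^^ n) (x (n + 0)) = x 0"
    by (rule funpow_string) (use x in \<open>simp add: is_string_def\<close>)
  moreover have "x n \<in> carrier G"
    using x by (auto simp: is_string_def)
  ultimately have "x n = x 0"
    using fix_n by simp
  with x n show False
    by (auto simp: is_string_def dest: injD)
qed

text \<open>If \<open>y i = y (i + k)\<close> in a sequence of successive preimages of \<open>y 0\<close>, then applying the map \<open>i\<close>
  times gives \<open>y 0 = y k\<close>, and \<open>k\<close> further applications show that \<open>y 0\<close> returns to itself
  after \<open>k\<close> steps.\<close>

lemma string_if_never_returns:
  assumes surj: "\<phi> ` carrier G = carrier G" and x: "x \<in> carrier G"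
    and never: "\<And>n. n > 0 \<Longrightarrow> (\<phi> ^^ n) x \<noteq> x"
  shows "\<exists>y. is_string G \<phi> y"
proof -
  have "\<exists>b. b \<in> carrier G \<and> \<phi> b = a" if "a \<in> carrier G" for a
    using that surj by (metis imageE)
  then obtain y where y: "\<And>n. y n \<in> carrier G" "\<And>n. \<phi> (y (Suc n)) = y n" and y0: "y 0 = x"
    using dependent_nat_choice[of "\<lambda>n a. a \<in> carrier G \<and> (n = 0 \<longrightarrow> a = x)" "\<lambda>_ a b. \<phi> b = a"] x
    by auto
  have distinct: "y i \<noteq> y (i + k)" if "k > 0" for i k
  proof
    assume eq: "y i = y (i + k)"
    have "y 0 = (\<phi> ^^ i) (y (i + 0))"
      by (rule funpow_string[symmetric]) (rule y)
    also have "\<dots> = (\<phi> ^^ i) (y (i + k))"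
      using eq by simp
    also have "\<dots> = y k"
      by (rule funpow_string) (rule y)
    finally have "(\<phi> ^^ k) (y 0) = (\<phi> ^^ k) (y (k + 0))"
      by simp
    also have "\<dots> = y 0"
      by (rule funpow_string) (rule y)
    finally show False
      using never[OF that] y0 by simp
  qed
  have "inj y"
  proof (rule linorder_injI)
    fix i j :: nat
    assume "i < j"
    then show "y i \<noteq> y j"
      using distinct[of "j - i" i] by simp
  qed
  moreover have "\<phi> (y n) = y (n - 1)" if "n > 0" for n
    using y(2)[of "n - 1"] that by simp
  ultimately show ?thesis
    using y(1) by (auto simp: is_string_def)
qed

lemma funpow_hom:
  assumes "f \<in> hom G G"
  shows "f ^^ n \<in> hom G G"
proof (induction n)
  case 0
  show ?case by (simp add: hom_def)
next
  case (Suc n)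
  then show ?case using assms by (simp add: hom_def Pi_iff)
qed

lemma (in group) hom_fixes_generate:
  assumes h: "h \<in> hom G G" and S: "S \<subseteq> carrier G"
    and fix_S: "\<And>s. s \<in> S \<Longrightarrow> h s = s" and x: "x \<in> generate G S"
  shows "h x = x"
proof -
  interpret h: group_hom G G h
    by unfold_locales (rule h)
  show ?thesis
    using x
  proof induction
    case (eng a b)
    then show ?case
      using generate_in_carrier[OF S] by simp
  qed (use S fix_S in auto)
qed

lemma common_period:
  fixes f :: "'a \<Rightarrow> 'a"
  assumes "finite S" and "\<And>s. s \<in> S \<Longrightarrow> \<exists>n>0. (f ^^ n) s = s"
  shows "\<exists>n>0. \<forall>s\<in>S. (f ^^ n) s = s"
proof -
  obtain p where p: "\<And>s. s \<in> S \<Longrightarrow> p s > 0 \<and> (f ^^ p s) s = s"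
    using assms(2) by metis
  have "(f ^^ prod p S) s = s" if s: "s \<in> S" for s
  proof -
    obtain k where k: "prod p S = p s * k"
      using dvd_prodI[OF assms(1) s, of p] by (auto elim: dvdE)
    have "((f ^^ p s) ^^ k) s = s"
      by (induction k) (simp_all add: p s)
    then show ?thesis
      by (simp add: k funpow_mult mult.commute)
  qed
  moreover have "prod p S > 0"
    using p by (simp add: prod_pos)
  ultimately show ?thesis by blast
qed

theorem mainTheorem7:
  fixes G :: "('a, 'b) monoid_scheme" and \<phi> :: "'a \<Rightarrow> 'a"
  assumes "comm_group G"
    and "finitely_generated G"
    and "\<phi> \<in> hom G G"
    and "\<phi> ` carrier G = carrier G"
  shows "string_number G \<phi> = 0 \<longleftrightarrow> periodic G \<phi>"
proof
  interpret comm_group G by (rule assms(1))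
  assume "string_number G \<phi> = 0"
  then have returns: "\<exists>n>0. (\<phi> ^^ n) x = x" if "x \<in> carrier G" for x
    using string_if_never_returns[OF assms(4) that] by (auto simp: string_number_eq_0_iff)
  obtain S where S: "finite S" "S \<subseteq> carrier G" "generate G S = carrier G"
    using assms(2) by (auto simp: finitely_generated_def)
  obtain n where n: "n > 0" "\<And>s. s \<in> S \<Longrightarrow> (\<phi> ^^ n) s = s"
    using common_period[OF S(1), of \<phi>] returns S(2) by blast
  have "(\<phi> ^^ n) x = x" if "x \<in> carrier G" for x
    using hom_fixes_generate[OF funpow_hom[OF assms(3)] S(2) n(2)] that S(3) by simp
  with n(1) show "periodic G \<phi>"
    by (auto simp: periodic_def)
next
  assume "periodic G \<phi>"
  then show "string_number G \<phi> = 0"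
    by (simp add: string_number_eq_0_iff no_string_if_periodic)
qed

end
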